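(* A locally compact group $G$ is approximable by finite semigroups if and only if it is approximable by finite groups.
   Context: Approximability: let $C\subseteq G$ be compact, $U$ a neighborhood of the unit, and $(H,\odot)$ a finite algebra (a set with one binary operation). $(H,j)$, $j:H\to G$, is a $(C,U)$-approximation of $G$ if $C\subseteq j(H)U$ and for all $x,y\in H$ with $j(x),j(y),j(x)j(y)\in C$ one has $j(x\odot y)\in j(x)j(y)U$. For a class $\mathcal K$ of finite algebras, $G$ is approximable by systems of $\mathcal K$ if for every compact $C\subseteq G$ and every neighborhood $U$ of the unit there is a $(C,U)$-approximation $(H,j)$ with $H\in\mathcal K$ and $j$ injective. *)

theory Defs
  imports "HOL-Analysis.Analysis"
begin

definition topological_group ::
  "('g::t2_space \<Rightarrow> 'g \<Rightarrow> 'g) \<Rightarrow> 'g \<Rightarrow> ('g \<Rightarrow> 'g) \<Rightarrow> bool" where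
  "topological_group mul e iv \<longleftrightarrow>
     (\<forall>x y z. mul (mul x y) z = mul x (mul y z)) \<and>
     (\<forall>x. mul e x = x \<and> mul x e = x) \<and>
     (\<forall>x. mul (iv x) x = e \<and> mul x (iv x) = e) \<and>
     continuous_on UNIV (\<lambda>p::'g \<times> 'g. mul (fst p) (snd p)) \<and>
     continuous_on UNIV iv"

definition locally_compact_group ::
  "('g::t2_space \<Rightarrow> 'g \<Rightarrow> 'g) \<Rightarrow> 'g \<Rightarrow> ('g \<Rightarrow> 'g) \<Rightarrow> bool" where
  "locally_compact_group mul e iv \<longleftrightarrow>
     topological_group mul e iv \<and> locally_compact_space (euclidean :: 'g topology)"

definition unit_nhd :: "'g::topological_space \<Rightarrow> 'g set \<Rightarrow> bool" where
  "unit_nhd e U \<longleftrightarrow> (\<exists>V. open V \<and> e \<in> V \<and> V \<subseteq> U)"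

text \<open>Finite algebras (H, op) are represented, up to isomorphism, with carrier a
  finite set of natural numbers and a binary operation closed on H.\<close>
definition finite_algebra :: "nat set \<Rightarrow> (nat \<Rightarrow> nat \<Rightarrow> nat) \<Rightarrow> bool" where
  "finite_algebra H op \<longleftrightarrow> finite H \<and> (\<forall>x\<in>H. \<forall>y\<in>H. op x y \<in> H)"

definition finite_semigroup :: "nat set \<Rightarrow> (nat \<Rightarrow> nat \<Rightarrow> nat) \<Rightarrow> bool" where
  "finite_semigroup H op \<longleftrightarrow> finite_algebra H op \<and>
     (\<forall>x\<in>H. \<forall>y\<in>H. \<forall>z\<in>H. op (op x y) z = op x (op y z))"

definition finite_group :: "nat set \<Rightarrow> (nat \<Rightarrow> nat \<Rightarrow> nat) \<Rightarrow> bool" where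
  "finite_group H op \<longleftrightarrow> finite_semigroup H op \<and>
     (\<exists>u\<in>H. (\<forall>x\<in>H. op u x = x \<and> op x u = x) \<and>
             (\<forall>x\<in>H. \<exists>y\<in>H. op x y = u \<and> op y x = u))"

definition CU_approximation ::
  "('g \<Rightarrow> 'g \<Rightarrow> 'g) \<Rightarrow> 'g set \<Rightarrow> 'g set \<Rightarrow> nat set \<Rightarrow> (nat \<Rightarrow> nat \<Rightarrow> nat) \<Rightarrow> (nat \<Rightarrow> 'g) \<Rightarrow> bool" where
  "CU_approximation mul C U H op j \<longleftrightarrow>
     C \<subseteq> {mul (j h) u | h u. h \<in> H \<and> u \<in> U} \<and>
     (\<forall>x\<in>H. \<forall>y\<in>H. j x \<in> C \<and> j y \<in> C \<and> mul (j x) (j y) \<in> C \<longrightarrow>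
        j (op x y) \<in> {mul (mul (j x) (j y)) u | u. u \<in> U})"

definition approximable_by ::
  "('g::topological_space \<Rightarrow> 'g \<Rightarrow> 'g) \<Rightarrow> 'g \<Rightarrow> (nat set \<Rightarrow> (nat \<Rightarrow> nat \<Rightarrow> nat) \<Rightarrow> bool) \<Rightarrow> bool" where
  "approximable_by mul e K \<longleftrightarrow>
     (\<forall>C U. compact C \<and> unit_nhd e U \<longrightarrow>
        (\<exists>H op j. K H op \<and> CU_approximation mul C U H op j \<and> inj_on j H))"

end

theory Submission
  imports Defs
begin

text \<open>
  Let \<open>H\<close> be a finite semigroup approximating \<open>G\<close> on a large compact set, and among the elements
  \<open>x\<close> with \<open>j x\<close> in a somewhat smaller compact set \<open>B\<close> choose one whose two-sided ideal \<open>H x H\<close> has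
  minimal cardinality. As \<open>G\<close> is a group, \<open>x\<close> can be multiplied by some \<open>y\<close> such that \<open>j (x y)\<close> is
  close to the unit, so we may assume that \<open>j x\<close> is close to the unit. Then \<open>x x\<close> and all \<open>x v x\<close>
  with \<open>j v\<close> in the given compact set are mapped into \<open>B\<close>, hence generate the same ideal as \<open>x\<close>. In a
  finite semigroup this forces them to lie in one maximal subgroup \<open>K\<close>, and \<open>K\<close> with the restriction
  of \<open>j\<close> is the required approximation: the elements \<open>x v x\<close> give density, and the approximate
  homomorphism property is inherited from \<open>H\<close>. The identity of \<open>K\<close> need not be mapped near the unit.
\<close>

section \<open>Maximal subgroups of finite semigroups\<close>

text \<open>This is \<open>H z H\<close> with no unit adjoined to \<open>H\<close>, so
  \<open>z\<close> need not be a member; that membership has to be arranged separately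
  later.\<close>

definition ideal_of :: "nat set \<Rightarrow> (nat \<Rightarrow> nat \<Rightarrow> nat) \<Rightarrow> nat \<Rightarrow> nat set" where
  "ideal_of H op z = {op (op a z) b | a b. a \<in> H \<and> b \<in> H}"

lemma finite_semigroupD:
  assumes "finite_semigroup H op"
  shows "finite H"
    and "\<And>x y. x \<in> H \<Longrightarrow> y \<in> H \<Longrightarrow> op x y \<in> H"
    and "\<And>x y z. x \<in> H \<Longrightarrow> y \<in> H \<Longrightarrow> z \<in> H \<Longrightarrow> op (op x y) z = op x (op y z)"
  using assms by (auto simp: finite_semigroup_def finite_algebra_def)

lemma finite_semigroup_opposite:
  assumes "finite_semigroup H op"
  shows "finite_semigroup H (\<lambda>x y. op y x)"
  using assms by (auto simp: finite_semigroup_def finite_algebra_def)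

lemma finite_ideal_of:
  assumes "finite_semigroup H op" "z \<in> H"
  shows "finite (ideal_of H op z)"
proof -
  have "ideal_of H op z \<subseteq> H"
    using finite_semigroupD[OF assms(1)] assms(2) by (auto simp: ideal_of_def)
  then show ?thesis
    using finite_semigroupD(1)[OF assms(1)] finite_subset by blast
qed

lemma ideal_of_mult_both_subset:
  assumes S: "finite_semigroup H op" and H: "x \<in> H" "a \<in> H" "b \<in> H"
  shows "ideal_of H op (op (op a x) b) \<subseteq> ideal_of H op x"
proof
  fix y assume "y \<in> ideal_of H op (op (op a x) b)"
  then obtain c d where cd: "c \<in> H" "d \<in> H" "y = op (op c (op (op a x) b)) d"
    by (auto simp: ideal_of_def)
  then have "y = op (op (op c a) x) (op b d)"
    using H by (simp add: finite_semigroupD[OF S])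
  then show "y \<in> ideal_of H op x"
    using cd H finite_semigroupD(2)[OF S] unfolding ideal_of_def by blast
qed

lemma ideal_of_mult_left_subset:
  assumes S: "finite_semigroup H op" and H: "x \<in> H" "a \<in> H"
  shows "ideal_of H op (op a x) \<subseteq> ideal_of H op x"
proof
  fix y assume "y \<in> ideal_of H op (op a x)"
  then obtain c d where cd: "c \<in> H" "d \<in> H" "y = op (op c (op a x)) d"
    by (auto simp: ideal_of_def)
  then have "y = op (op (op c a) x) d"
    using H by (simp add: finite_semigroupD[OF S])
  then show "y \<in> ideal_of H op x"
    using cd H finite_semigroupD(2)[OF S] unfolding ideal_of_def by blast
qed

text \<open>An instance of the stability of finite semigroups, by counting right ideals. Here
  \<open>R z\<close> is \<open>z\<close> together with \<open>z H\<close>. Left multiplication by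
  \<open>a\<close> carries \<open>R q\<close> onto \<open>R x\<close> for \<open>q = x x b\<close>,
  while \<open>R q\<close> lies in \<open>T = x x H\<close> and \<open>T\<close> in
  \<open>R x\<close>. Finiteness forces \<open>T = R x\<close>, so \<open>x\<close> is in
  \<open>T\<close>.\<close>

lemma square_divides_left:
  assumes S: "finite_semigroup H op" and H: "x \<in> H" "a \<in> H" "b \<in> H"
    and x: "x = op a (op (op x x) b)"
  shows "\<exists>s\<in>H. x = op (op x x) s"
proof -
  note [simp] = finite_semigroupD[OF S] and [simp] = H
  define R where "R z = insert z (op z ` H)" for z
  define q where "q = op (op x x) b"
  define T where "T = op (op x x) ` H"
  have "q \<in> H" by (simp add: q_def)
  have fin: "finite (R z)" for z by (simp add: R_def)
  have "R x = R (op a q)" using x by (simp add: q_def)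
  also have "\<dots> = op a ` R q"
    using \<open>q \<in> H\<close> by (auto simp: R_def image_iff)
  finally have "card (R x) \<le> card (R q)"
    using card_image_le[OF fin, of "op a" q] by simp
  also have "R q \<subseteq> T"
    by (auto simp: R_def T_def q_def)
  then have "card (R q) \<le> card T"
    by (intro card_mono) (auto simp: T_def)
  finally have "card (R x) \<le> card T" .
  moreover have "T \<subseteq> R x" by (auto simp: T_def R_def)
  ultimately have "T = R x" using card_seteq[OF fin] by blast
  then have "x \<in> T" by (simp add: R_def)
  then show ?thesis by (auto simp: T_def)
qed

text \<open>For an idempotent \<open>u\<close> of \<open>H\<close> this is the monoid
  \<open>u H u\<close>, with unit \<open>u\<close>.\<close>

definition local_monoid :: "nat set \<Rightarrow> (nat \<Rightarrow> nat \<Rightarrow> nat) \<Rightarrow> nat \<Rightarrow> nat set" where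
  "local_monoid H op u = {k \<in> H. op u k = k \<and> op k u = k}"

text \<open>The group of units of that monoid; for an idempotent \<open>u\<close> of
  \<open>H\<close>, the largest subgroup of \<open>H\<close> with identity \<open>u\<close>.\<close>

definition local_units :: "nat set \<Rightarrow> (nat \<Rightarrow> nat \<Rightarrow> nat) \<Rightarrow> nat \<Rightarrow> nat set" where
  "local_units H op u =
     {k \<in> local_monoid H op u. \<exists>k'\<in>local_monoid H op u. op k k' = u \<and> op k' k = u}"

lemma local_monoid_mult:
  assumes S: "finite_semigroup H op" and u: "u \<in> H"
    and p: "p \<in> local_monoid H op u" and q: "q \<in> local_monoid H op u"
  shows "op p q \<in> local_monoid H op u"
proof -
  have H: "p \<in> H" "q \<in> H" "op u p = p" "op q u = q"
    using p q by (auto simp: local_monoid_def)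
  have "op u (op p q) = op p q"
    using finite_semigroupD(3)[OF S u H(1,2)] H(3) by simp
  moreover have "op (op p q) u = op p q"
    using finite_semigroupD(3)[OF S H(1,2) u] H(4) by simp
  ultimately show ?thesis
    using H(1,2) finite_semigroupD(2)[OF S] by (simp add: local_monoid_def)
qed

lemma finite_group_local_units:
  assumes S: "finite_semigroup H op" and u: "u \<in> H" "op u u = u"
  shows "finite_group (local_units H op u) op"
proof -
  let ?M = "local_monoid H op u" and ?K = "local_units H op u"
  note assoc = finite_semigroupD(3)[OF S]
  have MH: "?M \<subseteq> H" and KM: "?K \<subseteq> ?M" by (auto simp: local_monoid_def local_units_def)
  have uM: "u \<in> ?M" using u by (simp add: local_monoid_def)
  have uK: "u \<in> ?K" using uM u by (auto simp: local_units_def)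
  have mult: "op k l \<in> ?K" if k: "k \<in> ?K" and l: "l \<in> ?K" for k l
  proof -
    obtain k' l' where k': "k' \<in> ?M" "op k k' = u" "op k' k = u"
      and l': "l' \<in> ?M" "op l l' = u" "op l' l = u"
      using k l by (auto simp: local_units_def)
    have M: "k \<in> ?M" "l \<in> ?M" using k l KM by auto
    have H: "k \<in> H" "l \<in> H" "k' \<in> H" "l' \<in> H" using M k' l' MH by auto
    note c = finite_semigroupD(2)[OF S]
    have "op (op k l) (op l' k') = op k (op (op l l') k')" using H by (simp add: assoc c)
    also have "\<dots> = u" using l' k' by (simp add: local_monoid_def)
    finally have 1: "op (op k l) (op l' k') = u" .
    have "op (op l' k') (op k l) = op l' (op (op k' k) l)" using H by (simp add: assoc c)
    also have "\<dots> = u" using l' k' M by (simp add: local_monoid_def)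
    finally have 2: "op (op l' k') (op k l) = u" .
    have "op k l \<in> ?M" "op l' k' \<in> ?M"
      using local_monoid_mult[OF S u(1)] M k'(1) l'(1) by auto
    then show ?thesis using 1 2 unfolding local_units_def by blast
  qed
  have inv: "\<exists>l\<in>?K. op k l = u \<and> op l k = u" if "k \<in> ?K" for k
    using that by (auto simp: local_units_def)
  have fin: "finite ?K" using finite_semigroupD(1)[OF S] KM MH by (metis finite_subset)
  have ass: "op (op x y) z = op x (op y z)" if "x \<in> ?K" "y \<in> ?K" "z \<in> ?K" for x y z
    using that KM MH by (meson assoc subsetD)
  have unit: "op u x = x \<and> op x u = x" if "x \<in> ?K" for x
    using that KM by (auto simp: local_monoid_def)
  have "finite_semigroup ?K op"
    using fin mult ass by (simp add: finite_semigroup_def finite_algebra_def)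
  moreover have "(\<forall>k\<in>?K. op u k = k \<and> op k u = k) \<and> (\<forall>k\<in>?K. \<exists>l\<in>?K. op k l = u \<and> op l k = u)"
    using unit inv by simp
  ultimately show ?thesis
    unfolding finite_group_def by (intro conjI) (assumption, rule bexI[OF _ uK])
qed

text \<open>Left multiplication by \<open>q\<close> is injective on the finite local monoid, because
  multiplying by \<open>p\<close> undoes it. Hence it is surjective, so \<open>q\<close> has a right
  inverse, which must be \<open>p\<close>.\<close>

lemma local_monoid_inverse_commute:
  assumes S: "finite_semigroup H op" and u: "u \<in> H"
    and p: "p \<in> local_monoid H op u" and q: "q \<in> local_monoid H op u" and pq: "op p q = u"
  shows "op q p = u"
proof -
  let ?M = "local_monoid H op u"
  have MH: "?M \<subseteq> H" by (auto simp: local_monoid_def)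
  have cancel: "op p (op q k) = k" if "k \<in> ?M" for k
  proof -
    have "p \<in> H" "q \<in> H" "k \<in> H" using p q that MH by auto
    then have "op p (op q k) = op (op p q) k"
      using finite_semigroupD(3)[OF S] by simp
    then show ?thesis using that pq by (simp add: local_monoid_def)
  qed
  have "inj_on (op q) ?M" by (metis cancel inj_onI)
  moreover have "op q ` ?M \<subseteq> ?M" using local_monoid_mult[OF S u q] by auto
  moreover have "finite ?M" using finite_semigroupD(1)[OF S] MH finite_subset by blast
  ultimately have "op q ` ?M = ?M" by (intro endo_inj_surj)
  moreover have "u \<in> ?M" using local_monoid_mult[OF S u p q] pq by simp
  ultimately obtain r where r: "r \<in> ?M" "op q r = u" by (metis imageE)
  then have "r = op p u" using cancel by metis
  then have "r = p" using p by (simp add: local_monoid_def)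
  then show ?thesis using r by simp
qed

text \<open>If \<open>x\<close> is in \<open>H x x H\<close>, stability makes \<open>x\<close> a
  right and a left multiple of \<open>x x\<close>. This yields an idempotent \<open>u\<close> that
  is a two-sided unit for \<open>x\<close>. Every \<open>x v x\<close> then lies in
  \<open>u H u\<close>, and it is invertible there once \<open>x\<close> can be recovered from
  it.\<close>

lemma maximal_subgroup_exists:
  assumes S: "finite_semigroup H op" and x: "x \<in> H" and sq: "x \<in> ideal_of H op (op x x)"
  obtains K where "K \<subseteq> H" "finite_group K op"
    "\<And>v. v \<in> H \<Longrightarrow> x \<in> ideal_of H op (op (op x v) x) \<Longrightarrow> op (op x v) x \<in> K"
proof -
  note [simp] = finite_semigroupD[OF S] and [simp] = x
  obtain a b where ab[simp]: "a \<in> H" "b \<in> H" and "x = op (op a (op x x)) b"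
    using sq by (auto simp: ideal_of_def)
  then have eq: "x = op a (op (op x x) b)" "x = op (op a (op x x)) b" by auto
  obtain s where s[simp]: "s \<in> H" and xs: "x = op (op x x) s"
    using square_divides_left[OF S x ab(1,2) eq(1)] by auto
  obtain t where t[simp]: "t \<in> H" and xt: "x = op t (op x x)"
    \<comment> \<open>Left-right dual: in the opposite semigroup \<open>a\<close> and
      \<open>b\<close> change places.\<close>
    using square_divides_left[OF finite_semigroup_opposite[OF S] x ab(2,1) eq(2)] by auto
  \<comment> \<open>The point is that also \<open>u = t x\<close>. The two forms give
    \<open>x u = x\<close> and \<open>u x = x\<close>, and then \<open>u u = u\<close>.\<close>
  define u where "u = op x s"
  have u[simp]: "u \<in> H" by (simp add: u_def)
  have "u = op (op t (op x x)) s" by (simp only: xt[symmetric] u_def)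
  also have "\<dots> = op t (op (op x x) s)" by simp
  also have "\<dots> = op t x" by (simp only: xs[symmetric])
  finally have ut: "u = op t x" .
  have "op u x = op t (op x x)" by (simp add: ut)
  then have ux: "op u x = x" by (simp only: xt[symmetric])
  have "op x u = op (op x x) s" by (simp add: u_def)
  then have xu: "op x u = x" by (simp only: xs[symmetric])
  have "op u (op x s) = op (op u x) s" by simp
  then have uu: "op u u = u" by (simp only: ux u_def[symmetric])
  let ?M = "local_monoid H op u"
  have "op (op x v) x \<in> local_units H op u"
    if v: "v \<in> H" and id: "x \<in> ideal_of H op (op (op x v) x)" for v
  proof -
    define z where "z = op (op x v) x"
    have z[simp]: "z \<in> H" using v by (simp add: z_def)
    have "op u z = op (op u x) (op v x)" "op z u = op (op x v) (op x u)"
      using v by (simp_all add: z_def)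
    then have uz: "op u z = z" "op z u = z"
      using v by (simp_all add: z_def ux xu)
    obtain c d where cd[simp]: "c \<in> H" "d \<in> H" and xcd: "x = op (op c z) d"
      using id by (auto simp: ideal_of_def z_def)
    \<comment> \<open>Compress \<open>c\<close> and \<open>d s\<close> into \<open>u H u\<close>.
      Since \<open>z\<close> absorbs \<open>u\<close> on both sides, \<open>p z q\<close> reduces to
      \<open>u (c z d s) u = u (x s) u = u\<close>.\<close>
    define p where "p = op u (op c u)"
    define q where "q = op u (op (op d s) u)"
    have pH[simp]: "p \<in> H" "q \<in> H" by (simp_all add: p_def q_def)
    have idem: "op u (op u k) = op u k" if "k \<in> H" for k
      using that uu finite_semigroupD(3)[OF S u u that] by simp
    have uzk: "op u (op z k) = op z k" "op z (op u k) = op z k" if "k \<in> H" for k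
      using that uz finite_semigroupD(3)[OF S u z that] finite_semigroupD(3)[OF S z u that] by simp_all
    have M: "p \<in> ?M" "q \<in> ?M" "z \<in> ?M"
      using uz uu by (simp_all add: local_monoid_def p_def q_def idem)
    have "op p (op z q) = op u (op (op (op (op c z) d) s) u)"
      by (simp add: p_def q_def uzk)
    also have "\<dots> = u" by (simp only: xcd[symmetric] u_def[symmetric] uu)
    finally have pzq: "op p (op z q) = u" .
    have zq: "op z q \<in> ?M"
      using M local_monoid_mult[OF S u] by auto
    \<comment> \<open>Commuting the one-sided inverses \<open>p\<close> and \<open>z q\<close>
      exhibits \<open>q p\<close> as a right inverse of \<open>z\<close>; commuting once more makes
      it two-sided.\<close>
    have 1: "op z (op q p) = u"
      using local_monoid_inverse_commute[OF S u M(1) zq pzq] by simp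
    have qp: "op q p \<in> ?M"
      using M local_monoid_mult[OF S u] by auto
    then have "op (op q p) z = u"
      using local_monoid_inverse_commute[OF S u M(3) qp 1] by simp
    with 1 qp M show ?thesis unfolding local_units_def z_def by blast
  qed
  moreover have "local_units H op u \<subseteq> H" by (auto simp: local_units_def local_monoid_def)
  ultimately show thesis
    using that finite_group_local_units[OF S u uu] by blast
qed

section \<open>Neighbourhoods of the unit\<close>

lemma unit_nhd_square:
  assumes G: "topological_group mul e iv" and V: "open V" "e \<in> V"
  obtains W where "open W" "e \<in> W" "\<And>x. x \<in> W \<Longrightarrow> iv x \<in> W"
    "\<And>x y. x \<in> W \<Longrightarrow> y \<in> W \<Longrightarrow> mul x y \<in> V"
proof -
  have id: "mul e x = x" "mul x e = x" and inv: "mul (iv x) x = e" "mul x (iv x) = e"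
    and assoc: "mul (mul x y) z = mul x (mul y z)"
    and cm: "continuous_on UNIV (\<lambda>p. mul (fst p) (snd p))" and ci: "continuous_on UNIV iv"
    for x y z
    using G unfolding topological_group_def by blast+
  have "open ((\<lambda>p. mul (fst p) (snd p)) -` V)"
    using cm V by (simp add: continuous_on_open_vimage)
  moreover have "(e, e) \<in> (\<lambda>p. mul (fst p) (snd p)) -` V" using V id by simp
  ultimately obtain A B where AB: "open A" "open B" "(e, e) \<in> A \<times> B"
      "A \<times> B \<subseteq> (\<lambda>p. mul (fst p) (snd p)) -` V"
    by (rule open_prod_elim) blast
  \<comment> \<open>Intersecting with the preimage under \<open>iv\<close> makes \<open>W\<close>
    symmetric, because \<open>iv\<close> is an involution.\<close>
  define W where "W = (A \<inter> B) \<inter> iv -` (A \<inter> B)"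
  have iviv: "iv (iv x) = x" for x using id inv assoc by metis
  have "iv e = e" using id inv by metis
  then have "e \<in> W" using AB by (simp add: W_def)
  moreover have "open W"
    unfolding W_def using AB ci by (intro open_Int) (auto simp: continuous_on_open_vimage)
  moreover have "iv x \<in> W" if "x \<in> W" for x using that iviv by (simp add: W_def)
  moreover have "mul x y \<in> V" if "x \<in> W" "y \<in> W" for x y
    using that AB(4) by (auto simp: W_def)
  ultimately show thesis using that by blast
qed

lemma compact_unit_nhd:
  fixes mul :: "'g::t2_space \<Rightarrow> 'g \<Rightarrow> 'g"
  assumes "locally_compact_group mul e iv"
  obtains N Q where "open N" "e \<in> N" "N \<subseteq> Q" "compact Q"
proof -
  have "locally_compact_space (euclidean :: 'g topology)"
    using assms by (simp add: locally_compact_group_def)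
  then have "\<exists>N Q. open N \<and> compact Q \<and> e \<in> N \<and> N \<subseteq> Q"
    by (simp add: locally_compact_space_def)
  then show thesis using that by blast
qed

lemma compact_product:
  assumes G: "topological_group mul e iv" and "compact A" "compact B"
  shows "compact {mul a b | a b. a \<in> A \<and> b \<in> B}"
proof -
  have "{mul a b | a b. a \<in> A \<and> b \<in> B} = (\<lambda>p. mul (fst p) (snd p)) ` (A \<times> B)"
    by force
  moreover have "continuous_on (A \<times> B) (\<lambda>p. mul (fst p) (snd p))"
    using G continuous_on_subset unfolding topological_group_def by blast
  ultimately show ?thesis using assms by (simp add: compact_continuous_image compact_Times)
qed

section \<open>From semigroups to groups\<close>

lemma group_approximation:
  fixes mul :: "'g::t2_space \<Rightarrow> 'g \<Rightarrow> 'g"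
  assumes LG: "locally_compact_group mul e iv"
    and app: "approximable_by mul e finite_semigroup"
    and C: "compact C" and U: "unit_nhd e U"
  shows "\<exists>H op j. finite_group H op \<and> CU_approximation mul C U H op j \<and> inj_on j H"
proof -
  have G: "topological_group mul e iv" using LG by (simp add: locally_compact_group_def)
  then interpret group mul e iv
    by unfold_locales (auto simp: topological_group_def)
  note gs = assoc left_inverse right_inverse left_neutral right_neutral
    inverse_distrib_swap inverse_inverse
  have lc: "mul (iv a) (mul a b) = b" "mul a (mul (iv a) b) = b" for a b
    by (metis assoc left_inverse left_neutral, metis assoc right_inverse left_neutral)
  obtain N Q where N: "open N" "e \<in> N" "N \<subseteq> Q" "compact Q"
    by (rule compact_unit_nhd[OF LG])
  obtain U' where U': "open U'" "e \<in> U'" "U' \<subseteq> U" using U by (auto simp: unit_nhd_def)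
  \<comment> \<open>\<open>V0\<close> lies in \<open>N\<close>, hence in the compact
    \<open>Q\<close>, and in \<open>U\<close>. Each further \<open>Vi\<close> is symmetric and has
    its pairwise products in the preceding one, so that the accumulated errors below stay in
    \<open>V0\<close>.\<close>
  have "open (N \<inter> U')" "e \<in> N \<inter> U'" using N U' by auto
  then obtain V0 where V0: "open V0" "e \<in> V0" "\<And>x. x \<in> V0 \<Longrightarrow> iv x \<in> V0"
      "\<And>x y. x \<in> V0 \<Longrightarrow> y \<in> V0 \<Longrightarrow> mul x y \<in> N \<inter> U'"
    by (rule unit_nhd_square[OF G]) blast
  obtain V1 where V1: "open V1" "e \<in> V1" "\<And>x. x \<in> V1 \<Longrightarrow> iv x \<in> V1"
      "\<And>x y. x \<in> V1 \<Longrightarrow> y \<in> V1 \<Longrightarrow> mul x y \<in> V0"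
    by (rule unit_nhd_square[OF G V0(1,2)]) blast
  obtain V2 where V2: "open V2" "e \<in> V2" "\<And>x. x \<in> V2 \<Longrightarrow> iv x \<in> V2"
      "\<And>x y. x \<in> V2 \<Longrightarrow> y \<in> V2 \<Longrightarrow> mul x y \<in> V1"
    by (rule unit_nhd_square[OF G V1(1,2)]) blast
  obtain V3 where V3: "open V3" "e \<in> V3" "\<And>x. x \<in> V3 \<Longrightarrow> iv x \<in> V3"
      "\<And>x y. x \<in> V3 \<Longrightarrow> y \<in> V3 \<Longrightarrow> mul x y \<in> V2"
    by (rule unit_nhd_square[OF G V2(1,2)]) blast
  obtain V4 where V4: "open V4" "e \<in> V4" "\<And>x. x \<in> V4 \<Longrightarrow> iv x \<in> V4"
      "\<And>x y. x \<in> V4 \<Longrightarrow> y \<in> V4 \<Longrightarrow> mul x y \<in> V3"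
    by (rule unit_nhd_square[OF G V3(1,2)]) blast
  have s0: "x \<in> N \<inter> U'" if "x \<in> V0" for x using V0(4)[OF that V0(2)] right_neutral by simp
  have s1: "x \<in> V0" if "x \<in> V1" for x using V1(4)[OF that V1(2)] right_neutral by simp
  have s2: "x \<in> V1" if "x \<in> V2" for x using V2(4)[OF that V2(2)] right_neutral by simp
  have s3: "x \<in> V2" if "x \<in> V3" for x using V3(4)[OF that V3(2)] right_neutral by simp
  have s4: "x \<in> V3" if "x \<in> V4" for x using V4(4)[OF that V4(2)] right_neutral by simp

  \<comment> \<open>\<open>P\<close> is closed under \<open>iv\<close> and contains \<open>C\<close>
    and \<open>V0\<close>. \<open>B0 = P P\<close> therefore contains all \<open>g d\<close> with
    \<open>g\<close> in \<open>C\<close> and \<open>d\<close> in \<open>V0\<close>; ideals are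
    minimised over it. \<open>H\<close> approximates on the larger \<open>B1 = B0 B0\<close>, which
    also contains auxiliary targets such as \<open>iv p g iv p\<close>.\<close>
  define P where "P = C \<union> iv ` C \<union> Q \<union> iv ` Q"
  define B0 where "B0 = {mul a b | a b. a \<in> P \<and> b \<in> P}"
  define B1 where "B1 = {mul a b | a b. a \<in> B0 \<and> b \<in> B0}"
  have "compact (iv ` A)" if "compact A" for A
    using G that compact_continuous_image continuous_on_subset
    unfolding topological_group_def by blast
  then have "compact P" unfolding P_def using C N(4) by (intro compact_Un) auto
  then have B1c: "compact B1"
    unfolding B1_def B0_def by (intro compact_product[OF G])
  have V0P: "x \<in> P" if "x \<in> V0" for x using s0[OF that] N(3) by (auto simp: P_def)
  have CP: "x \<in> P" if "x \<in> C" for x using that by (simp add: P_def)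
  have eP: "e \<in> P" using V0P V0(2) by simp
  have Pi: "iv x \<in> P" if "x \<in> P" for x using that by (auto simp: P_def gs)
  have PP: "mul x y \<in> B0" if "x \<in> P" "y \<in> P" for x y using that by (auto simp: B0_def)
  have PB0: "x \<in> B0" if "x \<in> P" for x using PP[OF that eP] right_neutral by simp
  have B0i: "iv x \<in> B0" if x: "x \<in> B0" for x
  proof -
    obtain a b where "x = mul a b" "a \<in> P" "b \<in> P" using x by (auto simp: B0_def)
    then show ?thesis using PP[OF Pi Pi, of b a] by (simp add: gs)
  qed
  have BB: "mul x y \<in> B1" if "x \<in> B0" "y \<in> B0" for x y using that by (auto simp: B1_def)
  have B01: "x \<in> B1" if "x \<in> B0" for x
    using BB[OF that PB0[OF eP]] right_neutral by simp

  \<comment> \<open>The approximating semigroup and a minimal ideal\<close>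
  have "unit_nhd e V4" using V4 by (auto simp: unit_nhd_def)
  then obtain H op j where S: "finite_semigroup H op"
    and CU: "CU_approximation mul B1 V4 H op j" and inj: "inj_on j H"
    using app B1c unfolding approximable_by_def by blast
  \<comment> \<open>Symmetry of \<open>V4\<close> moves the error to the other side of the equation,
    so that \<open>j h\<close> is expressed through the prescribed \<open>g\<close>.\<close>
  have app_cover: "\<exists>h\<in>H. \<exists>u\<in>V4. j h = mul g u" if g: "g \<in> B1" for g
  proof -
    obtain h u where "h \<in> H" "u \<in> V4" "g = mul (j h) u"
      using CU g by (auto simp: CU_approximation_def)
    then show ?thesis
      by (intro bexI[of _ h] bexI[of _ "iv u"]) (auto simp: gs V4(3))
  qed
  have app_mult: "\<exists>u\<in>V4. j (op a b) = mul (mul (j a) (j b)) u"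
    if "a \<in> H" "b \<in> H" "j a \<in> B1" "j b \<in> B1" "mul (j a) (j b) \<in> B1" for a b
    using CU that unfolding CU_approximation_def by blast
  note cl = finite_semigroupD(2)[OF S]

  obtain w uw where w: "w \<in> H" "uw \<in> V4" "j w = mul e uw"
    using app_cover B01[OF PB0[OF eP]] by blast
  then have jw: "j w \<in> V4" by (simp add: gs)
  then have "j w \<in> B0" by (simp add: PB0 V0P s1 s2 s3 s4)
  define x0 where "x0 = arg_min_on (\<lambda>x. card (ideal_of H op x)) {x \<in> H. j x \<in> B0}"
  have fin: "finite {x \<in> H. j x \<in> B0}" using finite_semigroupD(1)[OF S] by simp
  have ne: "{x \<in> H. j x \<in> B0} \<noteq> {}" using w(1) \<open>j w \<in> B0\<close> by blast
  have x0: "x0 \<in> H" "j x0 \<in> B0"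
    using arg_min_if_finite(1)[OF fin ne] by (auto simp: x0_def)
  \<comment> \<open>Ideals are finite, so minimal cardinality turns inclusion into equality.\<close>
  have min: "ideal_of H op z = ideal_of H op x0"
    if "z \<in> H" "j z \<in> B0" "ideal_of H op z \<subseteq> ideal_of H op x0" for z
  proof -
    have "card (ideal_of H op x0) \<le> card (ideal_of H op z)"
      unfolding x0_def
      using arg_min_least[OF fin ne, of z "\<lambda>x. card (ideal_of H op x)"] that(1,2) by simp
    then show ?thesis
      using that(3) finite_ideal_of[OF S x0(1)] by (meson card_seteq)
  qed

  \<comment> \<open>Moving the minimal element close to the unit\<close>
  obtain y uy where y: "y \<in> H" "uy \<in> V4" "j y = mul (iv (j x0)) uy"
    using app_cover B01[OF B0i[OF x0(2)]] by blast
  have xy: "mul (j x0) (j y) = uy" using y by (simp add: lc)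
  have "uy \<in> B0" using y by (simp add: PB0 V0P s1 s2 s3 s4)
  have "j y \<in> B1" using y B0i[OF x0(2)] \<open>uy \<in> B0\<close> by (simp add: BB)
  then obtain u1 where u1: "u1 \<in> V4" "j (op x0 y) = mul uy u1"
    using app_mult[of x0 y] x0 y B01 \<open>uy \<in> B0\<close> xy by auto
  have jxy: "j (op x0 y) \<in> V3" using u1 y V4(4) by simp
  have wxy: "mul (j w) (j (op x0 y)) \<in> V2" using jw jxy V3(4) s4 by simp
  obtain u2 where u2: "u2 \<in> V4" "j (op w (op x0 y)) = mul (mul (j w) (j (op x0 y))) u2"
    using app_mult[of w "op x0 y"] w(1) x0(1) y(1) cl jw jxy wxy B01 PB0 V0P s1 s2 s3 s4 by meson
  \<comment> \<open>The factor \<open>w\<close> serves only to obtain \<open>x \<in> H x H\<close>, since \<open>H\<close> need not have a unit.\<close>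
  define x where "x = op w (op x0 y)"
  have xw: "x = op (op w x0) y"
    using finite_semigroupD(3)[OF S] w(1) x0(1) y(1) by (simp add: x_def)
  have x: "x \<in> H" using w(1) x0(1) y(1) cl by (simp add: x_def)
  \<comment> \<open>Regrouping the four \<open>V4\<close> factors in pairs gives \<open>V2\<close>;
    multiplying the bound \<open>wxy\<close> by \<open>u2\<close> would only give
    \<open>V1\<close>.\<close>
  have "j x = mul (mul (j w) uy) (mul u1 u2)"
    using u2 u1 by (simp add: x_def gs)
  then have jx2: "j x \<in> V2" using jw y u1 u2 V4(4) V3(4) by simp
  have jx0: "j x \<in> B0" using jx2 PB0 V0P s1 s2 by simp
  have "x \<in> ideal_of H op x0"
    unfolding xw using w(1) y(1) by (auto simp: ideal_of_def)
  moreover have ideal_x: "ideal_of H op x = ideal_of H op x0"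
    using min[OF x jx0] ideal_of_mult_both_subset[OF S x0(1) w(1) y(1)] xw by simp
  ultimately have xx: "x \<in> ideal_of H op x" by simp

  have min_x: "x \<in> ideal_of H op z" if "z \<in> H" "j z \<in> B0" "ideal_of H op z \<subseteq> ideal_of H op x" for z
    using min[OF that(1,2)] that(3) ideal_x xx by simp
  have "mul (j x) (j x) \<in> V0" using jx2 V1(4) s2 by simp
  then obtain u3 where u3: "u3 \<in> V4" "j (op x x) = mul (mul (j x) (j x)) u3"
    using app_mult[of x x] x jx0 B01 PB0 V0P by meson
  have "j (op x x) \<in> B0"
    using u3 \<open>mul (j x) (j x) \<in> V0\<close> by (simp add: PP V0P s1 s2 s3 s4)
  then have "x \<in> ideal_of H op (op x x)"
    using x by (intro min_x cl ideal_of_mult_left_subset[OF S])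
  then obtain K where K: "K \<subseteq> H" "finite_group K op"
    "\<And>v. v \<in> H \<Longrightarrow> x \<in> ideal_of H op (op (op x v) x) \<Longrightarrow> op (op x v) x \<in> K"
    by (rule maximal_subgroup_exists[OF S x]) blast

  \<comment> \<open>Density of the maximal subgroup\<close>
  have dense: "\<exists>h\<in>K. \<exists>u\<in>U. g = mul (j h) u" if g: "g \<in> C" for g
  proof -
    define p where "p = j x"
    have p: "p \<in> V2" "iv p \<in> V2" using jx2 V2(3) by (auto simp: p_def)
    have ipP: "iv p \<in> P" using p V0P s1 s2 by simp
    \<comment> \<open>\<open>v\<close> is chosen with \<open>j v\<close> near
      \<open>iv p g iv p\<close>, so that the outer factors of \<open>x v x\<close> cancel up to a
      small error and leave \<open>g\<close>.\<close>
    have "mul (mul (iv p) g) (iv p) \<in> B1"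
      using BB[OF PP[OF ipP CP[OF g]] PB0[OF ipP]] .
    then obtain v uv where v: "v \<in> H" "uv \<in> V4" "j v = mul (mul (mul (iv p) g) (iv p)) uv"
      using app_cover by blast
    have pu: "mul (iv p) uv \<in> V1" using p v V2(4) s3 s4 by simp
    have "j v = mul (mul (iv p) g) (mul (iv p) uv)" using v by (simp add: gs)
    then have jv: "j v \<in> B1"
      using BB[OF PP[OF ipP CP[OF g]] PB0] pu V0P s1 by simp
    have pv: "mul (j x) (j v) = mul g (mul (iv p) uv)"
      using v by (simp add: gs lc p_def)
    also have "\<dots> \<in> B0" using g CP pu V0P s1 by (intro PP) auto
    finally obtain u4 where u4: "u4 \<in> V4" "j (op x v) = mul (mul g (mul (iv p) uv)) u4"
      using app_mult[of x v] x v jx0 jv B01 pv by metis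
    define t where "t = mul (iv p) (mul uv u4)"
    have t: "t \<in> V1" using p v u4 V4(4) V2(4) s3 by (simp add: t_def)
    have xv: "j (op x v) = mul g t" using u4 by (simp add: t_def gs)
    have xvB: "j (op x v) \<in> B0" using xv t g CP V0P s1 by (simp add: PP)
    have "mul (j (op x v)) (j x) = mul g (mul t p)" by (simp add: xv p_def gs)
    also have "\<dots> \<in> B0" using t p V1(4) s2 V0P CP[OF g] by (simp add: PP)
    finally obtain u5 where u5: "u5 \<in> V4" "j (op (op x v) x) = mul (mul (j (op x v)) (j x)) u5"
      using app_mult[of "op x v" x] x v jx0 cl xvB B01 by metis
    \<comment> \<open>The total error \<open>d\<close> is \<open>iv p uv u4 p u5\<close>. It is
      small because \<open>p\<close> itself is in \<open>V2\<close>, so no estimate for conjugates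
      of neighbourhoods is required.\<close>
    define d where "d = mul t (mul p u5)"
    have d: "d \<in> V0" using t p u5 V2(4) V1(4) s3 s4 by (simp add: d_def)
    have xvx: "j (op (op x v) x) = mul g d" using u5 by (simp add: xv p_def d_def gs)
    then have "j (op (op x v) x) \<in> B0" using d g CP V0P by (simp add: PP)
    then have "x \<in> ideal_of H op (op (op x v) x)"
      using x v(1) by (intro min_x cl ideal_of_mult_left_subset[OF S])
    then have "op (op x v) x \<in> K" using K(3) v by simp
    moreover have "g = mul (j (op (op x v) x)) (iv d)" by (simp add: xvx gs)
    moreover have "iv d \<in> U" using d V0(3) s0 U'(3) by blast
    ultimately show ?thesis by blast
  qed
  have "CU_approximation mul C U K op j"
    unfolding CU_approximation_def
  proof (intro conjI ballI impI)
    show "C \<subseteq> {mul (j h) u |h u. h \<in> K \<and> u \<in> U}" using dense by blast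
    fix a b assume "a \<in> K" "b \<in> K" "j a \<in> C \<and> j b \<in> C \<and> mul (j a) (j b) \<in> C"
    then have "\<exists>u\<in>V4. j (op a b) = mul (mul (j a) (j b)) u"
      using K(1) by (intro app_mult) (auto simp: B01 PB0 CP)
    then show "j (op a b) \<in> {mul (mul (j a) (j b)) u |u. u \<in> U}"
      using s0 s1 s2 s3 s4 U'(3) by blast
  qed
  moreover have "inj_on j K" using inj K(1) by (rule inj_on_subset)
  ultimately show ?thesis using K(2) by blast
qed

theorem theorem3:
  fixes mul :: "'g::t2_space \<Rightarrow> 'g \<Rightarrow> 'g" and e :: 'g and iv :: "'g \<Rightarrow> 'g"
  assumes "locally_compact_group mul e iv"
  shows "approximable_by mul e finite_semigroup \<longleftrightarrow> approximable_by mul e finite_group"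
proof
  assume "approximable_by mul e finite_semigroup"
  then show "approximable_by mul e finite_group"
    using group_approximation[OF assms] unfolding approximable_by_def[of _ _ finite_group] by blast
next
  assume "approximable_by mul e finite_group"
  then show "approximable_by mul e finite_semigroup"
    unfolding approximable_by_def finite_group_def by blast
qed

end
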